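(* Let $X$ be an $N$-dimensional real normed space, let $1\leqslant k\leqslant N$, and let $V=\Lambda^kX$ be equipped with the projective exterior norm; put $m=\dim V=\binom Nk$. Let $\eta$ be a (Borel) probability measure on the unit sphere $S_V$ and let $w\mapsto w^\sharp$ be an $\eta$-measurable selection of norming functionals on $S_V$. Then the following are equivalent: (i) $T_\eta=I_V$, where $T_\eta=m\int_{S_V}w\otimes w^\sharp\,\mathrm d\eta(w)$; (ii) for every $B\in\operatorname{End}(V)$, $$\operatorname{tr}(B)=m\int_{S_V} w^\sharp(Bw)\,\mathrm d\eta(w);$$ (iii) for every $A\in\operatorname{End}(X)$, $$\operatorname{tr}(\Lambda^kA)=m\int_{S_V} w^\sharp\big((\Lambda^kA)w\big)\,\mathrm d\eta(w).$$
   Context: For a finite-dimensional real normed space $V$, $S_V$ is its unit sphere and $V^*$ its dual with the dual norm. A norming functional at $w\in S_V$ is a functional $w^\sharp\in S_{V^*}$ with $w^\sharp(w)=1$; a measurable norming selection is an $\eta$-measurable map $w\mapsto w^\sharp$ choosing one such functional for each $w\in S_V$. For $w\in V$, $f\in V^*$, $w\otimes f\in\operatorname{End}(V)$ denotes the operator $(w\otimes f)(z)=f(z)w$. $\operatorname{End}(V)$ is the algebra of linear maps $V\to V$ and $I_V$ is the identity. The projective exterior norm on $\Lambda^kX$ is $$\|w\|_{\wedge,\pi}=\inf\Big\{\sum_{r=1}^s\prod_{j=1}^k\|x_j^{(r)}\| : w=\sum_{r=1}^s x_1^{(r)}\wedge\cdots\wedge x_k^{(r)}\Big\}.$$ $\Lambda^kA$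 is the operator induced by $A$ on $\Lambda^kX$, i.e. $(\Lambda^kA)(x_1\wedge\cdots\wedge x_k)=Ax_1\wedge\cdots\wedge Ax_k$. The number $\operatorname{tr}(\Lambda^kA)$ is called the $k$th higher trace $\lambda_k(A)$. *)

theory Defs
  imports "HOL-Probability.Probability" "HOL-Analysis.Finite_Function_Topology"
begin

section \<open>Finite-dimensional real normed spaces\<close>

(* The spanning condition is spelled out because span itself is not available inside a class
   specification; see finite_spanning_set. *)
class finite_dim_normed = real_normed_vector +
  assumes finite_spanning: "\<exists>B. finite B \<and> (\<forall>v. \<exists>c. v = (\<Sum>b\<in>B. c b *\<^sub>R b))"

lemma finite_spanning_set: "\<exists>B::'a::finite_dim_normed set. finite B \<and> span B = UNIV"
proof -
  obtain B :: "'a set" where B: "finite B" "\<And>v. \<exists>c. v = (\<Sum>b\<in>B. c b *\<^sub>R b)"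
    using finite_spanning by blast
  have "v \<in> span B" for v
    using B(2)[of v] by (auto intro!: span_sum span_scale intro: span_base)
  then show ?thesis using B(1) by blast
qed

instance euclidean_space \<subseteq> finite_dim_normed
proof
  show "\<exists>B::'a set. finite B \<and> (\<forall>v. \<exists>c. v = (\<Sum>b\<in>B. c b *\<^sub>R b))"
    using finite_Basis euclidean_representation[where 'a='a, symmetric] by blast
qed

lemma finite_dim_basis:
  obtains B :: "'a::finite_dim_normed set"
  where "finite B" "independent B" "span B = UNIV"
proof -
  obtain C :: "'a set" where C: "finite C" "span C = UNIV"
    using finite_spanning_set by blast
  obtain B where B: "B \<subseteq> C" "independent B" "C \<subseteq> span B"
    by (rule maximal_independent_subset)
  have "span B = UNIV"
    using B(3) C(2) span_minimal subspace_span by blast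
  moreover have "finite B" using B(1) C(1) finite_subset by blast
  ultimately show ?thesis using that B by blast
qed

lemma coordinates_bounded_span:
  fixes B :: "'a::real_normed_vector set"
  assumes "finite B" "independent B"
  shows "\<exists>K>0. \<forall>c. \<forall>b\<in>B. \<bar>c b\<bar> \<le> K * norm (\<Sum>b\<in>B. c b *\<^sub>R b)"
  using assms
proof (induction B rule: finite_induct)
  case empty
  show ?case by (rule exI[of _ 1]) simp
next
  case (insert a B)
  have indB: "independent B" and a: "a \<notin> span B"
    using insert.prems insert.hyps(2) by (simp_all add: independent_insert)
  obtain K where K: "K > 0"
    "\<And>c b. b \<in> B \<Longrightarrow> \<bar>c b\<bar> \<le> K * norm (\<Sum>b\<in>B. c b *\<^sub>R b)"
    using insert.IH[OF indB] by blast
  have "\<exists>d>0. \<forall>c. d \<le> norm (a - (\<Sum>b\<in>B. c b *\<^sub>R b))"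
  proof (rule ccontr)
    assume "\<not> ?thesis"
    then have "\<forall>n. \<exists>c. norm (a - (\<Sum>b\<in>B. c b *\<^sub>R b)) < inverse (real (Suc n))"
      by (metis inverse_positive_iff_positive not_le of_nat_0_less_iff zero_less_Suc)
    then obtain c where c: "\<And>n. norm (a - (\<Sum>b\<in>B. c n b *\<^sub>R b)) < inverse (real (Suc n))"
      by metis
    define s where "s n = (\<Sum>b\<in>B. c n b *\<^sub>R b)" for n
    have lim: "s \<longlonglongrightarrow> a"
    proof -
      have "(\<lambda>n. a - s n) \<longlonglongrightarrow> 0"
        by (rule Lim_null_comparison[OF _ LIMSEQ_inverse_real_of_nat])
          (use c in \<open>auto simp: s_def intro!: always_eventually less_imp_le\<close>)
      then have "(\<lambda>n. a - (a - s n)) \<longlonglongrightarrow> a - 0"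
        by (intro tendsto_intros)
      then show ?thesis by simp
    qed
    have Cs: "Cauchy s" using lim LIMSEQ_imp_Cauchy by blast
    have "\<exists>l. (\<lambda>n. c n b) \<longlonglongrightarrow> l" if b: "b \<in> B" for b
    proof -
      have "Cauchy (\<lambda>n. c n b)"
      proof (rule metric_CauchyI)
        fix e :: real assume "e > 0"
        then obtain M where M: "\<forall>m\<ge>M. \<forall>n\<ge>M. dist (s m) (s n) < e / K"
          using Cs K(1) unfolding Cauchy_def by (meson divide_pos_pos)
        have "dist (c m b) (c n b) < e" if mn: "m \<ge> M" "n \<ge> M" for m n
        proof -
          have "\<bar>c m b - c n b\<bar> \<le> K * norm (\<Sum>b\<in>B. (c m b - c n b) *\<^sub>R b)"
            using K(2)[OF b, of "\<lambda>b. c m b - c n b"] .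
          also have "(\<Sum>b\<in>B. (c m b - c n b) *\<^sub>R b) = s m - s n"
            by (simp add: s_def scaleR_diff_left sum_subtractf)
          also have "K * norm (s m - s n) < K * (e / K)"
            using M mn K(1) by (intro mult_strict_left_mono) (auto simp: dist_norm)
          finally show ?thesis using K(1) by (simp add: dist_norm)
        qed
        then show "\<exists>M. \<forall>m\<ge>M. \<forall>n\<ge>M. dist (c m b) (c n b) < e" by blast
      qed
      then show ?thesis using Cauchy_convergent convergent_def by blast
    qed
    then obtain l where l: "\<And>b. b \<in> B \<Longrightarrow> (\<lambda>n. c n b) \<longlonglongrightarrow> l b" by metis
    have "s \<longlonglongrightarrow> (\<Sum>b\<in>B. l b *\<^sub>R b)"
      unfolding s_def using l by (intro tendsto_intros)
    then have "a = (\<Sum>b\<in>B. l b *\<^sub>R b)" using lim LIMSEQ_unique by blast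
    also have "\<dots> \<in> span B" by (intro span_sum span_scale span_base)
    finally show False using a by contradiction
  qed
  then obtain d where d: "d > 0" "\<And>c. d \<le> norm (a - (\<Sum>b\<in>B. c b *\<^sub>R b))" by blast
  have ca: "\<bar>c a\<bar> \<le> inverse d * norm (\<Sum>b\<in>insert a B. c b *\<^sub>R b)" for c
  proof (cases "c a = 0")
    case True then show ?thesis using d(1) by simp
  next
    case False
    have "(\<Sum>b\<in>insert a B. c b *\<^sub>R b) = c a *\<^sub>R (a - (\<Sum>b\<in>B. (- c b / c a) *\<^sub>R b))"
      using insert.hyps False
      by (simp add: scaleR_add_right scaleR_sum_right sum_negf)
    then have "norm (\<Sum>b\<in>insert a B. c b *\<^sub>R b) = \<bar>c a\<bar> * norm (a - (\<Sum>b\<in>B. (- c b / c a) *\<^sub>R b))"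
      by simp
    also have "\<dots> \<ge> \<bar>c a\<bar> * d"
      by (rule mult_left_mono[OF d(2)[of "\<lambda>b. - c b / c a"]]) simp
    finally show ?thesis using d(1) by (simp add: field_simps)
  qed
  define K' where "K' = inverse d + K * (1 + inverse d * norm a)"
  have K'1: "inverse d \<le> K'" unfolding K'_def using K(1) d(1) by simp
  have K'2: "K * (1 + inverse d * norm a) \<le> K'" unfolding K'_def using d(1) by simp
  have K'0: "K' > 0" using K'1 d(1) by (meson less_le_trans positive_imp_inverse_positive)
  have "\<bar>c b\<bar> \<le> K' * norm (\<Sum>b\<in>insert a B. c b *\<^sub>R b)" if b: "b \<in> insert a B" for c b
  proof (cases "b = a")
    case True
    have "\<bar>c a\<bar> \<le> inverse d * norm (\<Sum>b\<in>insert a B. c b *\<^sub>R b)" by (rule ca)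
    also have "\<dots> \<le> K' * norm (\<Sum>b\<in>insert a B. c b *\<^sub>R b)"
      using K'1 by (intro mult_right_mono) auto
    finally show ?thesis using True by simp
  next
    case False
    let ?v = "\<Sum>b\<in>insert a B. c b *\<^sub>R b"
    have "\<bar>c b\<bar> \<le> K * norm (\<Sum>b\<in>B. c b *\<^sub>R b)" using K(2) False b by blast
    also have "(\<Sum>b\<in>B. c b *\<^sub>R b) = ?v - c a *\<^sub>R a" using insert.hyps by simp
    also have "K * norm (?v - c a *\<^sub>R a) \<le> K * (norm ?v + \<bar>c a\<bar> * norm a)"
      using K(1) norm_triangle_ineq4[of ?v "c a *\<^sub>R a"] by simp
    also have "\<dots> \<le> K * (norm ?v + (inverse d * norm ?v) * norm a)"
      using K(1) ca[of c] by (intro mult_left_mono add_left_mono mult_right_mono) auto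
    also have "\<dots> = (K * (1 + inverse d * norm a)) * norm ?v" by (simp add: algebra_simps)
    also have "\<dots> \<le> K' * norm ?v" using K'2 by (intro mult_right_mono) auto
    finally show ?thesis .
  qed
  then show ?case using K'0 by blast
qed

lemma sum_representation:
  assumes "finite B" "independent B" "span B = UNIV"
  shows "(\<Sum>b\<in>B. representation B v b *\<^sub>R b) = v"
  using assms real_vector.sum_representation_eq[of B v B] by simp

lemma representation_bounded:
  fixes B :: "'a::real_normed_vector set"
  assumes "finite B" "independent B" "span B = UNIV"
  shows "\<exists>K>0. \<forall>v. \<forall>b\<in>B. \<bar>representation B v b\<bar> \<le> K * norm v"
proof -
  obtain K where K: "K > 0" "\<And>c b. b \<in> B \<Longrightarrow> \<bar>c b\<bar> \<le> K * norm (\<Sum>b\<in>B. c b *\<^sub>R b)"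
    using coordinates_bounded_span[OF assms(1,2)] by blast
  then show ?thesis
    using sum_representation[OF assms] by (intro exI[of _ K]) metis
qed

lemma linear_representation:
  assumes "independent B" "span B = UNIV"
  shows "linear (\<lambda>v. representation B v b)"
  using assms by (intro linearI) (auto simp: representation_add representation_scale)

lemma finite_dim_linear_bounded:
  fixes f :: "'a::finite_dim_normed \<Rightarrow> 'b::real_normed_vector"
  assumes "linear f"
  shows "bounded_linear f"
proof -
  obtain B :: "'a set" where B: "finite B" "independent B" "span B = UNIV"
    by (rule finite_dim_basis)
  obtain K where K: "K > 0" "\<And>v b. b \<in> B \<Longrightarrow> \<bar>representation B v b\<bar> \<le> K * norm v"
    using representation_bounded[OF B] by blast
  have "norm (f v) \<le> norm v * (\<Sum>b\<in>B. K * norm (f b))" for v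
  proof -
    have "f v = f (\<Sum>b\<in>B. representation B v b *\<^sub>R b)" using sum_representation[OF B] by simp
    also have "\<dots> = (\<Sum>b\<in>B. representation B v b *\<^sub>R f b)"
      using assms by (simp add: linear_sum linear_scale)
    also have "norm \<dots> \<le> (\<Sum>b\<in>B. (K * norm v) * norm (f b))"
      using K(2) by (intro sum_norm_le) (auto intro!: mult_right_mono)
    finally show ?thesis by (simp add: sum_distrib_left mult_ac)
  qed
  then show ?thesis
    using assms by (auto simp: bounded_linear_def bounded_linear_axioms_def)
qed

instance finite_dim_normed \<subseteq> banach
proof
  fix X :: "nat \<Rightarrow> 'a"
  assume X: "Cauchy X"
  obtain B :: "'a set" where B: "finite B" "independent B" "span B = UNIV"
    by (rule finite_dim_basis)
  have "convergent (\<lambda>n. representation B (X n) b)" for b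
    using bounded_linear.Cauchy[OF finite_dim_linear_bounded[OF linear_representation[OF B(2,3)]] X]
    by (rule Cauchy_convergent)
  then obtain l where "\<And>b. (\<lambda>n. representation B (X n) b) \<longlonglongrightarrow> l b"
    unfolding convergent_def by metis
  then have "(\<lambda>n. \<Sum>b\<in>B. representation B (X n) b *\<^sub>R b) \<longlonglongrightarrow> (\<Sum>b\<in>B. l b *\<^sub>R b)"
    by (intro tendsto_intros)
  then show "convergent X" by (auto simp: sum_representation[OF B] convergent_def)
qed

instance finite_dim_normed \<subseteq> second_countable_topology
proof
  obtain B :: "'a set" where B: "finite B" "independent B" "span B = UNIV"
    by (rule finite_dim_basis)
  define D where "D = (\<lambda>c. \<Sum>b\<in>B. c b *\<^sub>R b) ` (PiE B (\<lambda>_. \<rat>))"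
  have cD: "countable D"
    unfolding D_def using B(1) by (intro countable_image countable_PiE) (auto simp: countable_rat)
  have dD: "\<exists>q\<in>D. dist v q < e" if e: "e > 0" for v e
  proof -
    define M where "M = 1 + (\<Sum>b\<in>B. norm b)"
    have M: "M > 0" unfolding M_def by (smt (verit) sum_nonneg norm_ge_zero)
    have "\<exists>q\<in>\<rat>. \<bar>representation B v b - q\<bar> < e / M" for b
    proof -
      obtain q where "q \<in> \<rat>" "representation B v b < q" "q < representation B v b + e / M"
        using Rats_dense_in_real[of "representation B v b" "representation B v b + e / M"] e M by auto
      then show ?thesis by (intro bexI[of _ q]) auto
    qed
    then obtain q where q: "\<And>b. q b \<in> \<rat>" "\<And>b. \<bar>representation B v b - q b\<bar> < e / M" by metis
    let ?q = "\<Sum>b\<in>B. restrict q B b *\<^sub>R b"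
    have "v - ?q = (\<Sum>b\<in>B. (representation B v b - q b) *\<^sub>R b)"
      by (simp add: scaleR_diff_left sum_subtractf sum_representation[OF B])
    also have "norm \<dots> \<le> (\<Sum>b\<in>B. (e / M) * norm b)"
      by (intro sum_norm_le) (auto simp del: times_divide_eq_left intro!: mult_right_mono less_imp_le[OF q(2)])
    also have "\<dots> = (e / M) * (\<Sum>b\<in>B. norm b)" by (simp add: sum_distrib_left)
    also have "\<dots> < (e / M) * M" using e M by (intro mult_strict_left_mono) (auto simp: M_def)
    finally have "dist v ?q < e" using M by (simp add: dist_norm)
    moreover have "?q \<in> D" unfolding D_def using q(1) by (intro imageI) auto
    ultimately show ?thesis by blast
  qed
  define \<B> where "\<B> = (\<lambda>(q, r). ball q r) ` (D \<times> (\<rat> :: real set))"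
  have "countable \<B>"
    unfolding \<B>_def using cD countable_rat by (intro countable_image countable_SIGMA) auto
  moreover have tb: "topological_basis \<B>"
  proof (rule topological_basisI)
    show "open A" if "A \<in> \<B>" for A using that by (auto simp: \<B>_def)
    fix U and v :: 'a assume U: "open U" "v \<in> U"
    then obtain e where e: "e > 0" "ball v e \<subseteq> U" using open_contains_ball by blast
    obtain r where r: "r \<in> \<rat>" "0 < r" "r < e / 2" using Rats_dense_in_real[of 0 "e/2"] e by auto
    obtain q where q: "q \<in> D" "dist v q < r" using dD[OF r(2)] by blast
    have "ball q r \<subseteq> ball v e"
    proof
      fix y assume "y \<in> ball q r"
      then show "y \<in> ball v e" using q(2) r(3) dist_triangle[of v y q] by simp
    qed
    then show "\<exists>B'\<in>\<B>. v \<in> B' \<and> B' \<subseteq> U"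
      using q r e by (intro bexI[of _ "ball q r"]) (auto simp: \<B>_def dist_commute)
  qed
  ultimately show "\<exists>B::'a set set. countable B \<and> open = generate_topology B"
    using topological_basis_imp_subbasis by blast
qed

lemma blinfun_coordinate_ex:
  fixes B :: "'a::finite_dim_normed set" and b :: 'a and v :: "'b::real_normed_vector"
  assumes "independent B" "span B = UNIV"
  shows "\<exists>g::'a \<Rightarrow>\<^sub>L 'b. \<forall>x. blinfun_apply g x = representation B x b *\<^sub>R v"
proof -
  have "bounded_linear (\<lambda>x. representation B x b *\<^sub>R v)"
    using finite_dim_linear_bounded[OF linear_representation[OF assms]]
      bounded_linear_scaleR_left bounded_linear_compose by blast
  then show ?thesis by (metis bounded_linear_Blinfun_apply)
qed

instance blinfun :: (finite_dim_normed, finite_dim_normed) finite_dim_normed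
proof
  obtain B :: "'a set" where B: "finite B" "independent B" "span B = UNIV"
    by (rule finite_dim_basis)
  obtain C :: "'b set" where C: "finite C" "independent C" "span C = UNIV"
    by (rule finite_dim_basis)
  have "\<forall>b c. \<exists>g::'a \<Rightarrow>\<^sub>L 'b. \<forall>x. blinfun_apply g x = representation B x b *\<^sub>R c"
    using blinfun_coordinate_ex[OF B(2,3)] by blast
  then obtain g :: "'a \<Rightarrow> 'b \<Rightarrow> ('a \<Rightarrow>\<^sub>L 'b)"
    where g: "\<And>b c x. blinfun_apply (g b c) x = representation B x b *\<^sub>R c" by metis
  let ?G = "(\<lambda>(b, c). g b c) ` (B \<times> C)"
  have *: "f \<in> span ?G" for f
  proof -
    have "f = (\<Sum>b\<in>B. \<Sum>c\<in>C. representation C (f b) c *\<^sub>R g b c)" (is "_ = ?h")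
    proof (rule blinfun_eqI)
      fix x
      have "blinfun_apply ?h x = (\<Sum>b\<in>B. representation B x b *\<^sub>R (\<Sum>c\<in>C. representation C (f b) c *\<^sub>R c))"
        by (simp add: blinfun.sum_left blinfun.scaleR_left g scaleR_sum_right mult_ac)
      also have "\<dots> = (\<Sum>b\<in>B. representation B x b *\<^sub>R blinfun_apply f b)"
        by (simp add: sum_representation[OF C])
      also have "\<dots> = blinfun_apply f (\<Sum>b\<in>B. representation B x b *\<^sub>R b)"
        by (simp add: blinfun.sum_right blinfun.scaleR_right)
      also have "\<dots> = blinfun_apply f x" by (simp add: sum_representation[OF B])
      finally show "blinfun_apply f x = blinfun_apply ?h x" by simp
    qed
    also have "\<dots> \<in> span ?G" by (intro span_sum span_scale span_base) auto
    finally show ?thesis .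
  qed
  have "finite ?G" using B(1) C(1) by simp
  then have "\<exists>c. f = (\<Sum>b\<in>?G. c b *\<^sub>R b)" for f
    using *[of f] unfolding span_finite[OF \<open>finite ?G\<close>] by blast
  with \<open>finite ?G\<close> show "\<exists>B::('a \<Rightarrow>\<^sub>L 'b) set. finite B \<and> (\<forall>v. \<exists>c. v = (\<Sum>b\<in>B. c b *\<^sub>R b))"
    by blast
qed

section \<open>Exterior powers\<close>

(* The factors of a wedge product are indexed by a finite type 'k, so that x :: 'k => 'a is a
   family (x_1, ..., x_k) with k = CARD('k).  No order on 'k is needed: the multilinearity and
   alternation relations only refer to positions. *)

definition ext_relations :: "(('k::finite \<Rightarrow> 'a::real_vector) \<Rightarrow>\<^sub>0 real) set" where
  "ext_relations =
     {Poly_Mapping.single (x(i := u + v)) 1 - Poly_Mapping.single (x(i := u)) 1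
        - Poly_Mapping.single (x(i := v)) 1 | x i u v. True}
   \<union> {Poly_Mapping.single (x(i := c *\<^sub>R u)) 1 - c *\<^sub>R Poly_Mapping.single (x(i := u)) 1 | x i c u. True}
   \<union> {Poly_Mapping.single x 1 | x i j. i \<noteq> j \<and> x i = x j}"

quotient_type (overloaded) ('a, 'k) ext_power =
  "('k::finite \<Rightarrow> 'a::real_vector) \<Rightarrow>\<^sub>0 real" / "\<lambda>p q. p - q \<in> span ext_relations"
proof (rule equivpI)
  show "reflp (\<lambda>p q. p - q \<in> span (ext_relations :: (('k \<Rightarrow> 'a) \<Rightarrow>\<^sub>0 real) set))"
    by (auto intro!: reflpI simp: span_zero)
  show "symp (\<lambda>p q. p - q \<in> span (ext_relations :: (('k \<Rightarrow> 'a) \<Rightarrow>\<^sub>0 real) set))"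
    by (rule sympI) (metis minus_diff_eq span_neg)
  show "transp (\<lambda>p q. p - q \<in> span (ext_relations :: (('k \<Rightarrow> 'a) \<Rightarrow>\<^sub>0 real) set))"
  proof (rule transpI)
    fix p q r :: "('k \<Rightarrow> 'a) \<Rightarrow>\<^sub>0 real"
    assume "p - q \<in> span ext_relations" "q - r \<in> span ext_relations"
    then have "(p - q) + (q - r) \<in> span ext_relations" by (rule span_add)
    then show "p - r \<in> span ext_relations" by simp
  qed
qed

instantiation ext_power :: (real_vector, finite) real_vector
begin

lift_definition zero_ext_power :: "('a, 'b) ext_power" is 0 .

lift_definition plus_ext_power :: "('a, 'b) ext_power \<Rightarrow> ('a, 'b) ext_power \<Rightarrow> ('a, 'b) ext_power"
  is "(+)"
proof -
  fix p p' q q' :: "('b \<Rightarrow> 'a) \<Rightarrow>\<^sub>0 real"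
  assume "p - p' \<in> span ext_relations" "q - q' \<in> span ext_relations"
  then have "(p - p') + (q - q') \<in> span ext_relations" by (rule span_add)
  then show "p + q - (p' + q') \<in> span ext_relations" by (simp add: algebra_simps)
qed

lift_definition uminus_ext_power :: "('a, 'b) ext_power \<Rightarrow> ('a, 'b) ext_power" is uminus
proof -
  fix p q :: "('b \<Rightarrow> 'a) \<Rightarrow>\<^sub>0 real"
  assume "p - q \<in> span ext_relations"
  then have "- (p - q) \<in> span ext_relations" by (rule span_neg)
  then show "- p - - q \<in> span ext_relations" by (simp add: algebra_simps)
qed

lift_definition minus_ext_power :: "('a, 'b) ext_power \<Rightarrow> ('a, 'b) ext_power \<Rightarrow> ('a, 'b) ext_power"
  is "(-)"
proof -
  fix p p' q q' :: "('b \<Rightarrow> 'a) \<Rightarrow>\<^sub>0 real"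
  assume "p - p' \<in> span ext_relations" "q - q' \<in> span ext_relations"
  then have "(p - p') - (q - q') \<in> span ext_relations" by (rule span_diff)
  then show "p - q - (p' - q') \<in> span ext_relations" by (simp add: algebra_simps)
qed

lift_definition scaleR_ext_power :: "real \<Rightarrow> ('a, 'b) ext_power \<Rightarrow> ('a, 'b) ext_power"
  is "scaleR"
proof -
  fix c :: real and p q :: "('b \<Rightarrow> 'a) \<Rightarrow>\<^sub>0 real"
  assume "p - q \<in> span ext_relations"
  then have "c *\<^sub>R (p - q) \<in> span ext_relations" by (rule span_scale)
  then show "c *\<^sub>R p - c *\<^sub>R q \<in> span ext_relations" by (simp add: algebra_simps)
qed

instance
  by standard (transfer; simp add: algebra_simps span_zero)+

end

lift_definition wedge :: "('k::finite \<Rightarrow> 'a::real_vector) \<Rightarrow> ('a, 'k) ext_power"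
  is "\<lambda>x. Poly_Mapping.single x 1" .

definition alternating_multilinear :: "(('k::finite \<Rightarrow> 'a::real_vector) \<Rightarrow> 'b::real_vector) \<Rightarrow> bool" where
  "alternating_multilinear \<phi> \<longleftrightarrow>
     (\<forall>x i. linear (\<lambda>v. \<phi> (x(i := v)))) \<and> (\<forall>x i j. i \<noteq> j \<and> x i = x j \<longrightarrow> \<phi> x = 0)"

lemma ext_relations_add:
  "Poly_Mapping.single (x(i := u + v)) 1
     - (Poly_Mapping.single (x(i := u)) 1 + Poly_Mapping.single (x(i := v)) 1) \<in> span ext_relations"
proof -
  have "Poly_Mapping.single (x(i := u + v)) 1 - Poly_Mapping.single (x(i := u)) 1
      - Poly_Mapping.single (x(i := v)) 1 \<in> ext_relations"
    unfolding ext_relations_def by blast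
  then show ?thesis by (simp add: span_base diff_diff_eq)
qed

lemma ext_relations_scale:
  "Poly_Mapping.single (x(i := c *\<^sub>R u)) 1 - c *\<^sub>R Poly_Mapping.single (x(i := u)) 1
     \<in> span ext_relations"
  by (rule span_base) (unfold ext_relations_def, blast)

lemma ext_relations_alt:
  assumes "i \<noteq> j" "x i = x j"
  shows "Poly_Mapping.single x 1 \<in> span ext_relations"
  by (rule span_base) (unfold ext_relations_def, use assms in blast)

lemma alternating_multilinear_wedge:
  "alternating_multilinear (wedge :: ('k::finite \<Rightarrow> 'a::real_vector) \<Rightarrow> ('a, 'k) ext_power)"
  unfolding alternating_multilinear_def
proof (intro conjI allI impI)
  fix x :: "'k \<Rightarrow> 'a" and i :: 'k
  show "linear (\<lambda>v. wedge (x(i := v)))"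
  proof (rule linearI)
    show "wedge (x(i := u + v)) = wedge (x(i := u)) + wedge (x(i := v))" for u v
      by transfer (rule ext_relations_add)
    show "wedge (x(i := c *\<^sub>R u)) = c *\<^sub>R wedge (x(i := u))" for c u
      by transfer (rule ext_relations_scale)
  qed
next
  fix x :: "'k \<Rightarrow> 'a" and i j :: 'k
  assume "i \<noteq> j \<and> x i = x j"
  then show "wedge x = 0"
    by transfer (auto intro: ext_relations_alt)
qed

lemma linear_wedge: "linear (\<lambda>v. wedge (x(i := v)))"
  and wedge_eq_0: "i \<noteq> j \<Longrightarrow> x i = x j \<Longrightarrow> wedge x = 0"
  using alternating_multilinear_wedge unfolding alternating_multilinear_def by blast+

lemma scaleR_single: "c *\<^sub>R Poly_Mapping.single x (d::real) = Poly_Mapping.single x (c * d)"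
  by (rule poly_mapping_eqI)
    (auto simp: scaleR_poly_mapping_def lookup_single when_def
      intro!: finite_subset[of _ "{x}"] split: if_splits)

lemma lookup_scaleR: "Poly_Mapping.lookup (c *\<^sub>R p) x = c * Poly_Mapping.lookup p (x :: 'b)"
  for p :: "'b \<Rightarrow>\<^sub>0 real"
proof -
  have "finite {i. c * Poly_Mapping.lookup p i \<noteq> 0}"
    by (rule finite_subset[OF _ finite_lookup[of p]]) auto
  then show ?thesis by (simp add: scaleR_poly_mapping_def)
qed

lemma poly_mapping_expand:
  fixes p :: "'b \<Rightarrow>\<^sub>0 real"
  shows "p = (\<Sum>x\<in>Poly_Mapping.keys p. Poly_Mapping.lookup p x *\<^sub>R Poly_Mapping.single x 1)"
  by (rule poly_mapping_eqI)
    (simp add: lookup_sum lookup_scaleR lookup_single when_def in_keys_iff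
      if_distrib[of "\<lambda>a. _ * a"] sum.delta cong: if_cong)

lemma span_wedge: "span (range wedge) = (UNIV :: ('a::real_vector, 'k::finite) ext_power set)"
proof -
  have "w \<in> span (range wedge)" for w :: "('a, 'k) ext_power"
  proof -
    obtain p where p: "w = abs_ext_power p"
      by (metis Quotient3_abs_rep[OF Quotient3_ext_power])
    have l: "linear (abs_ext_power :: _ \<Rightarrow> ('a, 'k) ext_power)"
      by (rule linearI) (simp_all add: plus_ext_power.abs_eq scaleR_ext_power.abs_eq)
    have "w = abs_ext_power (\<Sum>x\<in>Poly_Mapping.keys p. Poly_Mapping.lookup p x *\<^sub>R Poly_Mapping.single x 1)"
      using p poly_mapping_expand[of p] by simp
    also have "\<dots> = (\<Sum>x\<in>Poly_Mapping.keys p. Poly_Mapping.lookup p x *\<^sub>R wedge x)"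
      by (simp add: linear_sum[OF l] linear_scale[OF l] wedge.abs_eq)
    also have "\<dots> \<in> span (range wedge)" by (intro span_sum span_scale span_base) auto
    finally show ?thesis .
  qed
  then show ?thesis by blast
qed

lemma linear_eq_on_wedge:
  assumes "linear L" "linear M" "\<And>x. L (wedge x) = M (wedge x)"
  shows "L = M"
proof
  fix w
  show "L w = M w"
    using linear_eq_on_span[OF assms(1,2), of "range wedge" w] assms(3) span_wedge by auto
qed

lemma ext_power_universal:
  fixes \<phi> :: "('k::finite \<Rightarrow> 'a::real_vector) \<Rightarrow> 'b::real_vector"
  assumes "alternating_multilinear \<phi>"
  shows "\<exists>!L. linear L \<and> (\<forall>x. L (wedge x) = \<phi> x)"
proof -
  have lin: "linear (\<lambda>v. \<phi> (x(i := v)))" and alt: "i \<noteq> j \<Longrightarrow> x i = x j \<Longrightarrow> \<phi> x = 0" for x i j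
    using assms unfolding alternating_multilinear_def by blast+
  define F :: "(('k \<Rightarrow> 'a) \<Rightarrow>\<^sub>0 real) \<Rightarrow> 'b"
    where "F p = (\<Sum>x\<in>Poly_Mapping.keys p. Poly_Mapping.lookup p x *\<^sub>R \<phi> x)" for p
  have F_eq: "F p = (\<Sum>x\<in>S. Poly_Mapping.lookup p x *\<^sub>R \<phi> x)"
    if "finite S" "Poly_Mapping.keys p \<subseteq> S" for p S
    unfolding F_def using that by (intro sum.mono_neutral_left) (auto simp: in_keys_iff)
  have linF: "linear F"
  proof (rule linearI)
    fix p q :: "('k \<Rightarrow> 'a) \<Rightarrow>\<^sub>0 real" and c :: real
    let ?S = "Poly_Mapping.keys p \<union> Poly_Mapping.keys q"
    show "F (p + q) = F p + F q"
      using F_eq[of ?S p] F_eq[of ?S q] F_eq[of ?S "p + q"] Poly_Mapping.keys_add[of p q]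
      by (simp add: lookup_add scaleR_add_left sum.distrib)
    have "Poly_Mapping.keys (c *\<^sub>R p) \<subseteq> Poly_Mapping.keys p"
      by (auto simp: in_keys_iff lookup_scaleR)
    then show "F (c *\<^sub>R p) = c *\<^sub>R F p"
      using F_eq[of "Poly_Mapping.keys p" "c *\<^sub>R p"] F_eq[of "Poly_Mapping.keys p" p]
      by (simp add: lookup_scaleR scaleR_sum_right)
  qed
  have F_single: "F (Poly_Mapping.single x 1) = \<phi> x" for x
    by (simp add: F_def)
  have "F p = 0" if "p \<in> ext_relations" for p
    using that unfolding ext_relations_def
    by (auto simp: linear_diff[OF linF] linear_scale[OF linF] F_single
        linear_add[OF lin] linear_scale[OF lin] intro: alt)
  then have F0: "F p = 0" if "p \<in> span ext_relations" for p
    using linear_eq_0_on_span[OF linF] that by blast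
  define L :: "('a, 'k) ext_power \<Rightarrow> 'b" where "L w = F (rep_ext_power w)" for w
  have L_abs: "L (abs_ext_power p) = F p" for p
  proof -
    have "rep_ext_power (abs_ext_power p :: ('a, 'k) ext_power) - p \<in> span ext_relations"
      using Quotient3_ext_power by (rule rep_abs_rsp_left) (simp add: span_zero)
    from F0[OF this] show ?thesis by (simp add: L_def linear_diff[OF linF])
  qed
  have "linear L"
  proof (rule linearI)
    fix v w :: "('a, 'k) ext_power" and c :: real
    obtain p q where "v = abs_ext_power p" "w = abs_ext_power q"
      by (metis Quotient3_abs_rep[OF Quotient3_ext_power])
    then show "L (v + w) = L v + L w" "L (c *\<^sub>R v) = c *\<^sub>R L v"
      by (simp_all add: plus_ext_power.abs_eq scaleR_ext_power.abs_eq L_abs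
          linear_add[OF linF] linear_scale[OF linF])
  qed
  moreover have "L (wedge x) = \<phi> x" for x
    by (simp add: wedge.abs_eq L_abs F_single)
  ultimately show ?thesis using linear_eq_on_wedge by (metis (no_types, lifting))
qed

lemma wedge_in_span_basis:
  fixes B :: "'a::real_vector set" and x :: "'k::finite \<Rightarrow> 'a"
  assumes "span B = UNIV"
  shows "wedge x \<in> span (wedge ` {x. range x \<subseteq> B})"
proof -
  have "\<forall>x :: 'k \<Rightarrow> 'a. (\<forall>i. i \<notin> I \<longrightarrow> x i \<in> B) \<longrightarrow> wedge x \<in> span (wedge ` {x. range x \<subseteq> B})"
    if "finite I" for I
    using that
  proof (induction I)
    case empty
    then show ?case by (auto intro!: span_base)
  next
    case (insert i I)
    show ?case
    proof (intro allI impI)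
      fix x :: "'k \<Rightarrow> 'a" assume x: "\<forall>j. j \<notin> insert i I \<longrightarrow> x j \<in> B"
      let ?L = "\<lambda>v. wedge (x(i := v))"
      have "span (?L ` B) = range ?L"
        using linear_span_image[OF linear_wedge[of x i], of B] assms by simp
      then have "?L (x i) \<in> span (?L ` B)" by blast
      moreover have "?L ` B \<subseteq> span (wedge ` {x. range x \<subseteq> B})"
      proof
        fix y assume "y \<in> ?L ` B"
        then obtain b where b: "b \<in> B" "y = wedge (x(i := b))" by blast
        have "\<forall>j. j \<notin> I \<longrightarrow> (x(i := b)) j \<in> B" using x b(1) by auto
        then show "y \<in> span (wedge ` {x. range x \<subseteq> B})" using insert.IH b(2) by blast
      qed
      then have "span (?L ` B) \<subseteq> span (wedge ` {x. range x \<subseteq> B})"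
        by (intro span_minimal subspace_span)
      ultimately have "?L (x i) \<in> span (wedge ` {x. range x \<subseteq> B})" by blast
      then show "wedge x \<in> span (wedge ` {x. range x \<subseteq> B})" by simp
    qed
  qed
  from this[of UNIV] show ?thesis by auto
qed

lemma alternating_bounded:
  fixes \<phi> :: "('k::finite \<Rightarrow> 'a::finite_dim_normed) \<Rightarrow> 'b::real_normed_vector"
  assumes "alternating_multilinear \<phi>"
  shows "\<exists>C. \<forall>x. norm (\<phi> x) \<le> C * (\<Prod>j\<in>UNIV. norm (x j))"
proof -
  have lin: "linear (\<lambda>v. \<phi> (x(i := v)))" for x i
    using assms unfolding alternating_multilinear_def by blast
  obtain B :: "'a set" where B: "finite B" "independent B" "span B = UNIV"
    by (rule finite_dim_basis)
  obtain K where K: "K > 0" "\<And>v b. b \<in> B \<Longrightarrow> \<bar>representation B v b\<bar> \<le> K * norm v"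
    using representation_bounded[OF B] by blast
  have "\<exists>C\<ge>0. \<forall>x. (\<forall>i. i \<notin> I \<longrightarrow> x i \<in> B) \<longrightarrow> norm (\<phi> x) \<le> C * (\<Prod>j\<in>I. norm (x j))"
    if "finite I" for I
    using that
  proof (induction I)
    case empty
    have fin: "finite (PiE (UNIV :: 'k set) (\<lambda>_. B))" using B(1) by (intro finite_PiE) auto
    have "norm (\<phi> x) \<le> (\<Sum>x\<in>PiE UNIV (\<lambda>_. B). norm (\<phi> x))" if "\<forall>i. x i \<in> B" for x
      using that by (intro member_le_sum fin) auto
    then show ?case
      by (intro exI[of _ "\<Sum>x\<in>PiE UNIV (\<lambda>_. B). norm (\<phi> x)"]) (auto intro!: sum_nonneg)
  next
    case (insert i I)
    then obtain C where C: "C \<ge> 0"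
      "\<And>x. (\<forall>i. i \<notin> I \<longrightarrow> x i \<in> B) \<Longrightarrow> norm (\<phi> x) \<le> C * (\<Prod>j\<in>I. norm (x j))" by blast
    have "norm (\<phi> x) \<le> (real (card B) * K * C) * (\<Prod>j\<in>insert i I. norm (x j))"
      if x: "\<forall>j. j \<notin> insert i I \<longrightarrow> x j \<in> B" for x
    proof -
      let ?P = "\<Prod>j\<in>I. norm (x j)"
      have P0: "?P \<ge> 0" by (rule prod_nonneg) simp
      have "\<phi> x = \<phi> (x(i := \<Sum>b\<in>B. representation B (x i) b *\<^sub>R b))"
        by (simp add: sum_representation[OF B])
      also have "\<dots> = (\<Sum>b\<in>B. representation B (x i) b *\<^sub>R \<phi> (x(i := b)))"
        by (simp add: linear_sum[OF lin] linear_scale[OF lin])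
      also have "norm \<dots> \<le> (\<Sum>b\<in>B. (K * norm (x i)) * (C * ?P))"
      proof (rule sum_norm_le)
        fix b assume b: "b \<in> B"
        have "norm (\<phi> (x(i := b))) \<le> C * (\<Prod>j\<in>I. norm ((x(i := b)) j))"
          using x b by (intro C(2)) auto
        also have "(\<Prod>j\<in>I. norm ((x(i := b)) j)) = ?P"
          using insert.hyps(2) by (intro prod.cong) auto
        finally have "norm (\<phi> (x(i := b))) \<le> C * ?P" .
        then show "norm (representation B (x i) b *\<^sub>R \<phi> (x(i := b))) \<le> (K * norm (x i)) * (C * ?P)"
          using K b by (auto intro!: mult_mono)
      qed
      also have "\<dots> = (real (card B) * K * C) * (\<Prod>j\<in>insert i I. norm (x j))"
        using insert.hyps by (simp add: mult_ac)
      finally show ?thesis .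
    qed
    moreover have "real (card B) * K * C \<ge> 0" using K(1) C(1) by simp
    ultimately show ?case by blast
  qed
  from this[of UNIV] show ?thesis by auto
qed

subsection \<open>The projective exterior norm\<close>

lemma sum_lessThan_add:
  fixes f :: "nat \<Rightarrow> 'b::comm_monoid_add"
  shows "(\<Sum>r<m + n. f r) = (\<Sum>r<m. f r) + (\<Sum>r<n. f (m + r))"
  by (induction n) (simp_all add: add_ac)

definition wedge_costs :: "('a::real_normed_vector, 'k::finite) ext_power \<Rightarrow> real set" where
  "wedge_costs w =
     {\<Sum>r<s. \<Prod>j\<in>UNIV. norm (x r j) | (s::nat) (x :: nat \<Rightarrow> 'k \<Rightarrow> 'a). w = (\<Sum>r<s. wedge (x r))}"

lemma wedge_costs_nonneg: "t \<in> wedge_costs w \<Longrightarrow> 0 \<le> t"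
  unfolding wedge_costs_def by (auto intro!: sum_nonneg prod_nonneg)

lemma wedge_costs_zero: "0 \<in> wedge_costs 0"
  unfolding wedge_costs_def by (auto intro!: exI[of _ 0])

lemma wedge_costs_wedge: "(\<Prod>j\<in>UNIV. norm (x j)) \<in> wedge_costs (wedge x)"
  unfolding wedge_costs_def by (auto intro!: exI[of _ 1] exI[of _ "\<lambda>_. x"])

lemma wedge_costs_add:
  assumes "t \<in> wedge_costs v" "u \<in> wedge_costs w"
  shows "t + u \<in> wedge_costs (v + w)"
proof -
  obtain m :: nat and x where x: "t = (\<Sum>r<m. \<Prod>j\<in>UNIV. norm (x r j))" "v = (\<Sum>r<m. wedge (x r))"
    using assms(1) unfolding wedge_costs_def by blast
  obtain n :: nat and y where y: "u = (\<Sum>r<n. \<Prod>j\<in>UNIV. norm (y r j))" "w = (\<Sum>r<n. wedge (y r))"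
    using assms(2) unfolding wedge_costs_def by blast
  define z where "z r = (if r < m then x r else y (r - m))" for r
  have "v + w = (\<Sum>r<m + n. wedge (z r))" "t + u = (\<Sum>r<m + n. \<Prod>j\<in>UNIV. norm (z r j))"
    by (simp_all add: x y z_def sum_lessThan_add)
  then show ?thesis unfolding wedge_costs_def by blast
qed

lemma wedge_scaleR_ex:
  fixes x :: "'k::finite \<Rightarrow> 'a::real_normed_vector"
  shows "\<exists>y. wedge y = c *\<^sub>R wedge x \<and> (\<Prod>j\<in>UNIV. norm (y j)) = \<bar>c\<bar> * (\<Prod>j\<in>UNIV. norm (x j))"
proof -
  define i where "i = (undefined :: 'k)"
  let ?y = "x(i := c *\<^sub>R x i)"
  have "wedge ?y = c *\<^sub>R wedge (x(i := x i))"
    by (rule linear_scale[OF linear_wedge])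
  moreover have "(\<Prod>j\<in>UNIV. norm (?y j)) = \<bar>c\<bar> * (\<Prod>j\<in>UNIV. norm (x j))"
    by (simp add: prod.remove[of UNIV i])
  ultimately show ?thesis by (intro exI[of _ ?y]) simp
qed

lemma wedge_costs_scaleR:
  assumes "t \<in> wedge_costs w"
  shows "\<bar>c\<bar> * t \<in> wedge_costs (c *\<^sub>R w)"
proof -
  obtain m :: nat and x where x: "t = (\<Sum>r<m. \<Prod>j\<in>UNIV. norm (x r j))" "w = (\<Sum>r<m. wedge (x r))"
    using assms(1) unfolding wedge_costs_def by blast
  obtain y where y: "\<And>r. wedge (y r) = c *\<^sub>R wedge (x r)"
    "\<And>r. (\<Prod>j\<in>UNIV. norm (y r j)) = \<bar>c\<bar> * (\<Prod>j\<in>UNIV. norm (x r j))"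
    using wedge_scaleR_ex[of c "x _"] by metis
  have "c *\<^sub>R w = (\<Sum>r<m. wedge (y r))" "\<bar>c\<bar> * t = (\<Sum>r<m. \<Prod>j\<in>UNIV. norm (y r j))"
    by (simp_all add: x y scaleR_sum_right sum_distrib_left)
  then show ?thesis unfolding wedge_costs_def by blast
qed

lemma wedge_costs_nonempty: "wedge_costs w \<noteq> {}"
proof -
  have "w \<in> span (range wedge)" using span_wedge by blast
  then have "\<exists>t. t \<in> wedge_costs w"
  proof (induction rule: span_induct_alt)
    case base
    show ?case using wedge_costs_zero by blast
  next
    case (step c w1 w2)
    then show ?case using wedge_costs_wedge wedge_costs_scaleR wedge_costs_add by blast
  qed
  then show ?thesis by blast
qed

lemma bdd_below_wedge_costs: "bdd_below (wedge_costs w)"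
  using wedge_costs_nonneg by (intro bdd_belowI[of _ 0])

lemma wedge_costs_bounded_below:
  fixes w :: "('a::finite_dim_normed, 'k::finite) ext_power"
  assumes "w \<noteq> 0"
  shows "\<exists>d>0. \<forall>t\<in>wedge_costs w. d \<le> t"
proof -
  obtain f :: "('a, 'k) ext_power \<Rightarrow> real" where f: "linear f" "f w = 1"
    using linear_independent_extend[of "{w}" "\<lambda>_. 1::real"] assms by auto
  have "alternating_multilinear (\<lambda>x. f (wedge x))"
    unfolding alternating_multilinear_def
    using linear_compose[OF linear_wedge f(1), unfolded comp_def] wedge_eq_0 linear_0[OF f(1)]
    by metis
  then obtain C where C: "\<And>x. \<bar>f (wedge x)\<bar> \<le> C * (\<Prod>j\<in>UNIV. norm (x j))"
    using alternating_bounded by fastforce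
  define D where "D = max C 1"
  have D: "D > 0" "\<And>x. \<bar>f (wedge x)\<bar> \<le> D * (\<Prod>j\<in>UNIV. norm (x j))"
  proof -
    show "D > 0" by (simp add: D_def)
    fix x :: "'k \<Rightarrow> 'a"
    have "C * (\<Prod>j\<in>UNIV. norm (x j)) \<le> D * (\<Prod>j\<in>UNIV. norm (x j))"
      by (intro mult_right_mono prod_nonneg) (auto simp: D_def)
    then show "\<bar>f (wedge x)\<bar> \<le> D * (\<Prod>j\<in>UNIV. norm (x j))" using C[of x] by linarith
  qed
  have "1 / D \<le> t" if t: "t \<in> wedge_costs w" for t
  proof -
    obtain m :: nat and x where x: "t = (\<Sum>r<m. \<Prod>j\<in>UNIV. norm (x r j))" "w = (\<Sum>r<m. wedge (x r))"
      using t unfolding wedge_costs_def by blast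
    have "1 = \<bar>\<Sum>r<m. f (wedge (x r))\<bar>"
      using f(2) unfolding x by (simp add: linear_sum[OF f(1)])
    also have "\<dots> \<le> (\<Sum>r<m. \<bar>f (wedge (x r))\<bar>)" by (rule sum_abs)
    also have "\<dots> \<le> (\<Sum>r<m. D * (\<Prod>j\<in>UNIV. norm (x r j)))" by (intro sum_mono D(2))
    also have "\<dots> = D * t" by (simp add: x sum_distrib_left)
    finally show ?thesis using D(1) by (simp add: field_simps)
  qed
  then show ?thesis using D(1) by (intro exI[of _ "1 / D"]) auto
qed

instantiation ext_power :: (finite_dim_normed, finite) real_normed_vector
begin

definition norm_ext_power :: "('a, 'b) ext_power \<Rightarrow> real" where
  "norm_ext_power w = Inf {\<Sum>r<s. \<Prod>j\<in>UNIV. norm (x r j) |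
                   (s::nat) (x :: nat \<Rightarrow> 'b \<Rightarrow> 'a). w = (\<Sum>r<s. wedge (x r))}"

definition dist_ext_power :: "('a, 'b) ext_power \<Rightarrow> ('a, 'b) ext_power \<Rightarrow> real" where
  "dist_ext_power v w = norm (v - w)"

definition sgn_ext_power :: "('a, 'b) ext_power \<Rightarrow> ('a, 'b) ext_power" where
  "sgn_ext_power w = w /\<^sub>R norm w"

definition uniformity_ext_power :: "(('a, 'b) ext_power \<times> ('a, 'b) ext_power) filter" where
  "uniformity_ext_power = (INF e\<in>{0 <..}. principal {(v, w). dist v w < e})"

definition open_ext_power :: "('a, 'b) ext_power set \<Rightarrow> bool" where
  "open_ext_power U = (\<forall>v\<in>U. \<forall>\<^sub>F (v', w) in uniformity. v' = v \<longrightarrow> w \<in> U)"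

instance
proof
  have norm_eq: "norm w = Inf (wedge_costs w)" for w :: "('a, 'b) ext_power"
    by (simp add: norm_ext_power_def wedge_costs_def)
  have le: "norm w \<le> t" if "t \<in> wedge_costs w" for w :: "('a, 'b) ext_power" and t
    unfolding norm_eq using that bdd_below_wedge_costs by (rule cInf_lower)
  have ge: "t \<le> norm w" if "\<And>u. u \<in> wedge_costs w \<Longrightarrow> t \<le> u" for w :: "('a, 'b) ext_power" and t
    unfolding norm_eq using wedge_costs_nonempty that by (rule cInf_greatest)
  fix v w :: "('a, 'b) ext_power" and c :: real
  show "norm w = 0 \<longleftrightarrow> w = 0"
  proof
    assume "norm w = 0"
    then show "w = 0" using wedge_costs_bounded_below[of w] ge[of w] by fastforce
  next
    assume "w = 0"
    then show "norm w = 0" using le[OF wedge_costs_zero] ge[OF wedge_costs_nonneg, of w] by simp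
  qed
  show "norm (v + w) \<le> norm v + norm w"
  proof -
    have "norm (v + w) - u \<le> t" if "t \<in> wedge_costs v" "u \<in> wedge_costs w" for t u
      using le[OF wedge_costs_add[OF that]] by simp
    then have "norm (v + w) - u \<le> norm v" if "u \<in> wedge_costs w" for u
      using that by (intro ge)
    then have "norm (v + w) - norm v \<le> u" if "u \<in> wedge_costs w" for u
      using that by (simp add: algebra_simps)
    then have "norm (v + w) - norm v \<le> norm w" by (rule ge)
    then show ?thesis by simp
  qed
  have scale_le: "norm (c *\<^sub>R w) \<le> \<bar>c\<bar> * norm w" if c: "c \<noteq> 0" for c and w :: "('a, 'b) ext_power"
  proof -
    have "norm (c *\<^sub>R w) / \<bar>c\<bar> \<le> norm w"
      using le[OF wedge_costs_scaleR] c by (intro ge) (simp add: field_simps)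
    then show ?thesis using c by (simp add: field_simps)
  qed
  show "norm (c *\<^sub>R w) = \<bar>c\<bar> * norm w"
  proof (cases "c = 0")
    case True
    then show ?thesis using le[OF wedge_costs_zero] ge[OF wedge_costs_nonneg, of 0] by simp
  next
    case False
    have "norm w \<le> \<bar>inverse c\<bar> * norm (c *\<^sub>R w)"
      using scale_le[of "inverse c" "c *\<^sub>R w"] False by simp
    then have "\<bar>c\<bar> * norm w \<le> norm (c *\<^sub>R w)" using False by (simp add: field_simps)
    then show ?thesis using scale_le[OF False, of w] by simp
  qed
qed (simp_all add: dist_ext_power_def sgn_ext_power_def uniformity_ext_power_def open_ext_power_def)

end

instance ext_power :: (finite_dim_normed, finite) finite_dim_normed
proof
  obtain B :: "'a set" where B: "finite B" "independent B" "span B = UNIV"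
    by (rule finite_dim_basis)
  let ?W = "wedge ` {x :: 'b \<Rightarrow> 'a. range x \<subseteq> B}"
  have "{x :: 'b \<Rightarrow> 'a. range x \<subseteq> B} = PiE UNIV (\<lambda>_. B)" by auto
  then have fin: "finite ?W" using B(1) by (simp add: finite_PiE)
  have "range wedge \<subseteq> span ?W" using wedge_in_span_basis[OF B(3)] by blast
  then have "span ?W = UNIV"
    using span_minimal[OF _ subspace_span] span_wedge by blast
  then have "\<exists>c. v = (\<Sum>b\<in>?W. c b *\<^sub>R b)" for v
    using span_finite[OF fin] by blast
  then show "\<exists>B::('a, 'b) ext_power set. finite B \<and> (\<forall>v. \<exists>c. v = (\<Sum>b\<in>B. c b *\<^sub>R b))"
    using fin by blast
qed

subsection \<open>Dimension\<close>

lemma wedge_transpose: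
  assumes "a \<noteq> b"
  shows "wedge (x \<circ> Transposition.transpose a b) = - wedge x"
proof -
  let ?w = "\<lambda>u v. wedge (x(a := u, b := v))"
  have 1: "?w (u + u') v = ?w u v + ?w u' v" for u u' v
    using linear_add[OF linear_wedge[of "x(b := v)" a], of u u'] assms by (simp add: fun_upd_twist)
  have 2: "?w u (v + v') = ?w u v + ?w u v'" for u v v'
    using linear_add[OF linear_wedge[of "x(a := u)" b], of v v'] by simp
  have 0: "?w u u = 0" for u
    using assms by (intro wedge_eq_0[of a b]) auto
  have "?w (x a + x b) (x a + x b) = ?w (x a) (x a) + ?w (x b) (x a) + (?w (x a) (x b) + ?w (x b) (x b))"
    by (simp only: 1 2)
  then have "0 = ?w (x a) (x b) + ?w (x b) (x a)" by (simp only: 0 add_0_left add_0_right add.commute)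
  then have "?w (x b) (x a) = - ?w (x a) (x b)" by (metis add_eq_0_iff)
  moreover have "x \<circ> Transposition.transpose a b = x(a := x b, b := x a)"
    by (auto simp: fun_eq_iff Transposition.transpose_def)
  ultimately show ?thesis by simp
qed

lemma wedge_permute:
  assumes "p permutes UNIV"
  shows "wedge (x \<circ> p) = wedge x \<or> wedge (x \<circ> p) = - wedge x"
  using finite assms
proof (induction rule: permutes_rev_induct)
  case id
  then show ?case by simp
next
  case (swap a b p)
  then show ?case using wedge_transpose[of a b "x \<circ> p"] by (metis comp_assoc minus_minus)
qed

lemma alternating_multilinear_det:
  fixes B :: "'a::real_vector set" and e :: "'k::finite \<Rightarrow> 'a"
  assumes "independent B" "span B = UNIV"
  shows "alternating_multilinear (\<lambda>x. det (\<chi> i j. representation B (x i) (e j) :: real^'k^'k))"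
  unfolding alternating_multilinear_def
proof (intro conjI allI impI)
  fix x :: "'k \<Rightarrow> 'a" and i :: 'k
  let ?r = "\<lambda>v. (\<chi> j. representation B v (e j)) :: real^'k"
  have eq: "(\<chi> l j. representation B ((x(i := v)) l) (e j)) = (\<chi> l. if l = i then ?r v else ?r (x l))" for v
    by (simp add: vec_eq_iff)
  have radd: "?r (u + v) = ?r u + ?r v" and rscale: "?r (c *\<^sub>R u) = c *s ?r u" for u v c
    using assms by (simp_all add: vec_eq_iff representation_add representation_scale)
  show "linear (\<lambda>v. det (\<chi> l j. representation B ((x(i := v)) l) (e j) :: real^'k^'k))"
    unfolding eq
    by (rule linearI) (simp_all only: radd rscale det_row_add det_row_mul real_scaleR_def)
next
  fix x :: "'k \<Rightarrow> 'a" and i j :: 'k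
  assume ij: "i \<noteq> j \<and> x i = x j"
  show "det (\<chi> i j. representation B (x i) (e j) :: real^'k^'k) = 0"
    using ij by (intro det_identical_rows[of i j]) (auto simp: row_def)
qed

theorem dim_ext_power:
  "dim (UNIV :: ('a::finite_dim_normed, 'k::finite) ext_power set) = dim (UNIV :: 'a set) choose CARD('k)"
proof -
  obtain B :: "'a set" where B: "finite B" "independent B" "span B = UNIV"
    by (rule finite_dim_basis)
  define \<S> where "\<S> = {S. S \<subseteq> B \<and> card S = CARD('k)}"
  have finS: "finite S" if "S \<in> \<S>" for S
    using that B(1) finite_subset unfolding \<S>_def by blast
  have "\<exists>e. bij_betw e (UNIV :: 'k set) S" if "S \<in> \<S>" for S
    using that finS[OF that] finite_same_card_bij[of "UNIV :: 'k set" S] unfolding \<S>_def by auto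
  then obtain e :: "'a set \<Rightarrow> 'k \<Rightarrow> 'a" where e: "\<And>S. S \<in> \<S> \<Longrightarrow> bij_betw (e S) UNIV S"
    by metis
  let ?d = "\<lambda>S x. det (\<chi> i j. representation B (x i) (e S j) :: real^'k^'k)"
  have "\<forall>S. \<exists>L. linear L \<and> (\<forall>x. L (wedge x) = ?d S x)"
    using ext_power_universal[OF alternating_multilinear_det[OF B(2,3)]] by blast
  then obtain L where L: "\<And>S. linear (L S)" "\<And>S x. L S (wedge x) = ?d S x" by metis
  have eB: "e S i \<in> B" if "S \<in> \<S>" for S i
    using that e[OF that] unfolding \<S>_def bij_betw_def by blast
  have delta: "L S (wedge (e T)) = (if S = T then 1 else 0)" if S: "S \<in> \<S>" and T: "T \<in> \<S>" for S T
  proof (cases "S = T")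
    case True
    have "(\<chi> i j. representation B (e S i) (e S j)) = (mat 1 :: real^'k^'k)"
      using e[OF S] eB[OF S]
      by (auto simp: vec_eq_iff mat_def representation_basis[OF B(2)] bij_betw_def dest: injD)
    then show ?thesis using True by (simp add: L(2))
  next
    case False
    have "\<not> T \<subseteq> S"
      using False S T card_subset_eq[OF finS[OF S], of T] unfolding \<S>_def by auto
    then have "\<not> range (e T) \<subseteq> S" using bij_betw_imp_surj_on[OF e[OF T]] by simp
    then obtain i where i: "e T i \<notin> S" by blast
    have "representation B (e T i) (e S j) = 0" for j
    proof -
      have "e S j \<in> S" using bij_betw_imp_surj_on[OF e[OF S]] by blast
      then have "e S j \<noteq> e T i" using i by metis
      then show ?thesis by (simp add: representation_basis[OF B(2) eB[OF T]])
    qed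
    then have "det (\<chi> i j. representation B (e T i) (e S j) :: real^'k^'k) = 0"
      by (intro det_zero_row(2)[of i]) (simp add: row_def vec_eq_iff)
    then show ?thesis using False by (simp add: L(2))
  qed
  define W where "W = (\<lambda>S. wedge (e S)) ` \<S>"
  have fin\<S>: "finite \<S>" unfolding \<S>_def using B(1) by simp
  have inj: "inj_on (\<lambda>S. wedge (e S)) \<S>"
    by (rule inj_onI) (metis delta zero_neq_one)
  have "independent W"
  proof (rule independent_if_scalars_zero)
    show "finite W" unfolding W_def using fin\<S> by simp
    fix f w assume sum: "(\<Sum>w\<in>W. f w *\<^sub>R w) = 0" and "w \<in> W"
    then obtain S where S: "S \<in> \<S>" "w = wedge (e S)" unfolding W_def by blast
    have "(\<Sum>w\<in>W. f w *\<^sub>R w) = (\<Sum>T\<in>\<S>. f (wedge (e T)) *\<^sub>R wedge (e T))"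
      unfolding W_def using sum.reindex[OF inj] by (simp add: comp_def)
    then have "0 = L S (\<Sum>T\<in>\<S>. f (wedge (e T)) *\<^sub>R wedge (e T))"
      using sum linear_0[OF L(1)] by simp
    also have "\<dots> = (\<Sum>T\<in>\<S>. f (wedge (e T)) * (if S = T then 1 else 0))"
      by (simp add: linear_sum[OF L(1)] linear_scale[OF L(1)] delta[OF S(1)] cong: sum.cong)
    also have "\<dots> = f w" using S fin\<S> by (simp add: if_distrib cong: if_cong)
    finally show "f w = 0" by simp
  qed
  moreover have "span W = UNIV"
  proof -
    have "wedge x \<in> span W" if x: "range x \<subseteq> B" for x :: "'k \<Rightarrow> 'a"
    proof (cases "inj x")
      case False
      then obtain i j where "i \<noteq> j" "x i = x j" unfolding inj_def by blast
      then show ?thesis by (simp add: wedge_eq_0 span_zero)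
    next
      case True
      let ?S = "range x"
      have S: "?S \<in> \<S>" using x True by (simp add: \<S>_def card_image)
      define p where "p = inv_into UNIV (e ?S) \<circ> x"
      have "bij_betw x UNIV ?S" using True by (simp add: bij_betw_def)
      then have "bij_betw p UNIV UNIV"
        unfolding p_def using bij_betw_inv_into[OF e[OF S]] by (rule bij_betw_trans)
      then have p: "p permutes UNIV" by (rule bij_imp_permutes) simp
      have "x = e ?S \<circ> p"
        using bij_betw_inv_into_right[OF e[OF S]] by (auto simp: p_def fun_eq_iff)
      then have "wedge x = wedge (e ?S) \<or> wedge x = - wedge (e ?S)"
        using wedge_permute[OF p, of "e ?S"] by simp
      moreover have "wedge (e ?S) \<in> span W" using S by (auto simp: W_def intro: span_base)
      ultimately show ?thesis using span_neg by metis
    qed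
    then have "wedge ` {x. range x \<subseteq> B} \<subseteq> span W" by blast
    then have "span (wedge ` {x. range x \<subseteq> B}) \<subseteq> span W" by (intro span_minimal subspace_span)
    then have "range wedge \<subseteq> span W" using wedge_in_span_basis[OF B(3)] by blast
    then have "span (range wedge) \<subseteq> span W" by (intro span_minimal subspace_span)
    then show ?thesis using span_wedge by blast
  qed
  ultimately have "dim (UNIV :: ('a, 'k) ext_power set) = card W"
    using dim_eq_card[of W UNIV] by simp
  also have "\<dots> = card \<S>" unfolding W_def by (rule card_image[OF inj])
  also have "\<dots> = card B choose CARD('k)" unfolding \<S>_def by (rule n_subsets[OF B(1)])
  also have "card B = dim (UNIV :: 'a set)" using B dim_eq_card[of B UNIV] by simp
  finally show ?thesis .
qed

section \<open>Induced operators and traces\<close>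

definition ext_op :: "('a::real_vector \<Rightarrow> 'a) \<Rightarrow> ('a, 'k::finite) ext_power \<Rightarrow> ('a, 'k) ext_power" where
  "ext_op A = (THE L. linear L \<and> (\<forall>x. L (wedge x) = wedge (A \<circ> x)))"

lemma
  fixes A :: "'a::real_vector \<Rightarrow> 'a"
  assumes "linear A"
  shows linear_ext_op: "linear (ext_op A :: ('a, 'k::finite) ext_power \<Rightarrow> ('a, 'k) ext_power)"
    and ext_op_wedge: "ext_op A (wedge x) = wedge (A \<circ> (x :: 'k \<Rightarrow> 'a))"
proof -
  have "linear (\<lambda>v. wedge (A \<circ> x(i := v)))" for x :: "'k \<Rightarrow> 'a" and i
  proof -
    have "A \<circ> x(i := v) = (A \<circ> x)(i := A v)" for v by (auto simp: fun_eq_iff)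
    then show ?thesis
      using linear_compose[OF assms linear_wedge[of "A \<circ> x" i]] by (simp add: o_def)
  qed
  then have "alternating_multilinear (\<lambda>x :: 'k \<Rightarrow> 'a. wedge (A \<circ> x))"
    unfolding alternating_multilinear_def by (auto intro: wedge_eq_0)
  from theI'[OF ext_power_universal[OF this]]
  show "linear (ext_op A :: ('a, 'k) ext_power \<Rightarrow> ('a, 'k) ext_power)"
    and "ext_op A (wedge x) = wedge (A \<circ> (x :: 'k \<Rightarrow> 'a))"
    unfolding ext_op_def by auto
qed

(* The library only has the trace of a square matrix. *)
definition op_trace :: "('v::real_vector \<Rightarrow> 'v) \<Rightarrow> real" where
  "op_trace f =
     (let B = (SOME B. independent B \<and> span B = UNIV) in \<Sum>b\<in>B. representation B (f b) b)"

lemma op_trace_basis_indep: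
  assumes "linear f"
    and B: "finite B" "independent B" "span B = UNIV"
    and C: "finite C" "independent C" "span C = UNIV"
  shows "(\<Sum>b\<in>B. representation B (f b) b) = (\<Sum>c\<in>C. representation C (f c) c)"
proof -
  have "(\<Sum>b\<in>B. representation B (f b) b)
      = (\<Sum>b\<in>B. representation B (f (\<Sum>c\<in>C. representation C b c *\<^sub>R c)) b)"
    by (simp add: sum_representation[OF C])
  also have "\<dots> = (\<Sum>b\<in>B. \<Sum>c\<in>C. representation C b c * representation B (f c) b)"
    by (simp add: linear_sum[OF assms(1)] linear_scale[OF assms(1)]
        linear_sum[OF linear_representation[OF B(2,3)]] linear_scale[OF linear_representation[OF B(2,3)]])
  also have "\<dots> = (\<Sum>c\<in>C. \<Sum>b\<in>B. representation B (f c) b * representation C b c)"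
    by (subst sum.swap) (simp add: mult.commute)
  also have "\<dots> = (\<Sum>c\<in>C. representation C (\<Sum>b\<in>B. representation B (f c) b *\<^sub>R b) c)"
    by (simp add: linear_sum[OF linear_representation[OF C(2,3)]]
        linear_scale[OF linear_representation[OF C(2,3)]])
  also have "\<dots> = (\<Sum>c\<in>C. representation C (f c) c)"
    by (simp add: sum_representation[OF B])
  finally show ?thesis .
qed

lemma op_trace_eq:
  fixes f :: "'v::finite_dim_normed \<Rightarrow> 'v"
  assumes "linear f" "independent B" "span B = UNIV"
  shows "op_trace f = (\<Sum>b\<in>B. representation B (f b) b)"
proof -
  obtain C :: "'v set" where C: "finite C" "independent C" "span C = UNIV"
    by (rule finite_dim_basis)
  have fin: "finite D" if "independent D" for D :: "'v set"
    using independent_span_bound[OF C(1) that] C(3) by simp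
  let ?P = "\<lambda>D :: 'v set. independent D \<and> span D = UNIV"
  have "?P (SOME D. ?P D)" by (rule someI[of ?P B]) (use assms in simp)
  then show ?thesis
    unfolding op_trace_def Let_def
    using op_trace_basis_indep[OF assms(1), of "SOME D. ?P D" B] fin assms(2,3) by blast
qed

section \<open>Norming functionals and rank-one operators\<close>

definition norming_functional :: "'v::real_normed_vector \<Rightarrow> ('v \<Rightarrow>\<^sub>L real) \<Rightarrow> bool" where
  "norming_functional w f \<longleftrightarrow> norm f = 1 \<and> blinfun_apply f w = 1"

(* On a finite-dimensional space every linear operator is bounded, so the operators 'v =>L 'v make
   up all of End('v); as a Banach space this is where operator-valued Bochner integrals live. *)
lift_definition rank_one :: "'v::real_normed_vector \<Rightarrow> ('v \<Rightarrow>\<^sub>L real) \<Rightarrow> ('v \<Rightarrow>\<^sub>L 'v)"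
  is "\<lambda>w f z. f z *\<^sub>R w"
  by (rule bounded_linear_scaleR_left[THEN bounded_linear_compose])

end

(* Both T_eta = id and the trace formula only have to be tested on the rank-one operators
   z \<mapsto> \<phi>(z) c, where op_trace gives \<phi>(c) and the integral gives \<phi>(T_eta c).
   For (iii) no density or irreducibility argument is needed: in a basis of the exterior power made
   of wedges of basis vectors of X, every matrix unit is itself of the form \<Lambda>\<^sup>k A, namely for the
   A that sends the factors of one basis wedge to those of another and kills the other basis
   vectors of X.  Linearity then extends the formula from matrix units to all operators. *)

theory Submission
  imports Defs
begin

section \<open>Traces and matrix units\<close>

lemma linear_scaleR_left_compose: "linear \<phi> \<Longrightarrow> linear (\<lambda>w. \<phi> w *\<^sub>R c)"
  for \<phi> :: "'v::real_vector \<Rightarrow> real"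
  by (rule linearI) (simp_all add: linear_add linear_scale scaleR_add_left)

text \<open>In any basis the diagonal entry at \<open>b\<close> is the \<open>b\<close>-coordinate
  of \<open>c\<close> times \<open>\<phi> b\<close>; linearity of \<open>\<phi>\<close> collects
  these terms.\<close>

lemma op_trace_functional_scaleR:
  fixes c :: "'v::finite_dim_normed"
  assumes "linear \<phi>"
  shows "op_trace (\<lambda>w. \<phi> w *\<^sub>R c) = \<phi> c"
proof -
  obtain D :: "'v set" where D: "finite D" "independent D" "span D = UNIV"
    by (rule finite_dim_basis)
  have "op_trace (\<lambda>w. \<phi> w *\<^sub>R c) = (\<Sum>b\<in>D. representation D c b * \<phi> b)"
    using D(2,3)
    by (simp add: op_trace_eq[OF linear_scaleR_left_compose[OF assms]] representation_scale mult.commute)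
  also have "\<dots> = \<phi> (\<Sum>b\<in>D. representation D c b *\<^sub>R b)"
    by (simp add: linear_sum[OF assms] linear_scale[OF assms])
  finally show ?thesis by (simp add: sum_representation[OF D])
qed

lemma op_trace_linear_combination:
  fixes F :: "'i \<Rightarrow> 'v::finite_dim_normed \<Rightarrow> 'v"
  assumes "\<And>i. i \<in> I \<Longrightarrow> linear (F i)"
  shows "op_trace (\<lambda>w. \<Sum>i\<in>I. a i *\<^sub>R F i w) = (\<Sum>i\<in>I. a i * op_trace (F i))"
proof -
  obtain D :: "'v set" where D: "finite D" "independent D" "span D = UNIV"
    by (rule finite_dim_basis)
  have "linear (\<lambda>w. \<Sum>i\<in>I. a i *\<^sub>R F i w)"
    using assms by (intro linear_compose_sum ballI linear_compose_scale_right)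
  then have "op_trace (\<lambda>w. \<Sum>i\<in>I. a i *\<^sub>R F i w)
      = (\<Sum>b\<in>D. \<Sum>i\<in>I. a i * representation D (F i b) b)"
    by (simp add: op_trace_eq[OF _ D(2,3)] linear_sum[OF linear_representation[OF D(2,3)]]
        linear_scale[OF linear_representation[OF D(2,3)]])
  also have "\<dots> = (\<Sum>i\<in>I. a i * op_trace (F i))"
    by (subst sum.swap) (simp add: op_trace_eq[OF assms D(2,3)] sum_distrib_left)
  finally show ?thesis .
qed

text \<open>The summand at \<open>(b, c)\<close> is the matrix unit sending \<open>b\<close> to
  \<open>c\<close> and the rest of \<open>D\<close> to 0, weighted by the matrix entry of
  \<open>B\<close>. Expanding first \<open>w\<close> and then each \<open>B b\<close> in the basis
  produces it.\<close>

lemma linear_matrix_units: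
  assumes D: "finite D" "independent D" "span D = UNIV" and "linear B"
  shows "B = (\<lambda>w. \<Sum>(b, c)\<in>D \<times> D. representation D (B b) c *\<^sub>R (representation D w b *\<^sub>R c))"
proof
  fix w
  have "B w = B (\<Sum>b\<in>D. representation D w b *\<^sub>R b)" by (simp add: sum_representation[OF D])
  also have "\<dots> = (\<Sum>b\<in>D. representation D w b *\<^sub>R B b)"
    by (simp only: linear_sum[OF assms(4)] linear_scale[OF assms(4)])
  also have "\<dots> = (\<Sum>b\<in>D. representation D w b *\<^sub>R (\<Sum>c\<in>D. representation D (B b) c *\<^sub>R c))"
    by (simp add: sum_representation[OF D])
  also have "\<dots> = (\<Sum>(b, c)\<in>D \<times> D. representation D (B b) c *\<^sub>R (representation D w b *\<^sub>R c))"
    by (simp add: scaleR_sum_right sum.cartesian_product mult.commute)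
  finally show "B w = (\<Sum>(b, c)\<in>D \<times> D. representation D (B b) c *\<^sub>R (representation D w b *\<^sub>R c))" .
qed

section \<open>The trace formula for an integral of rank-one operators\<close>

lemma pairing_integral:
  fixes f :: "'v::finite_dim_normed \<Rightarrow> ('v \<Rightarrow>\<^sub>L real)"
  assumes "integrable M (\<lambda>w. rank_one w (f w))" "linear \<phi>"
  shows integrable_pairing_rank_one: "integrable M (\<lambda>w. blinfun_apply (f w) (\<phi> w *\<^sub>R c))"
    and integral_pairing_rank_one: "(\<integral>w. blinfun_apply (f w) (\<phi> w *\<^sub>R c) \<partial>M)
      = \<phi> (blinfun_apply (\<integral>w. rank_one w (f w) \<partial>M) c)"
proof -
  \<comment> \<open>Evaluating an operator at \<open>c\<close> and applying \<open>\<phi>\<close> is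
    a bounded linear functional, so it passes through the Bochner integral; \<open>eq\<close> shows
    that the pairing is this functional at \<open>rank_one w (f w)\<close>.\<close>
  have bl: "bounded_linear (\<lambda>R :: 'v \<Rightarrow>\<^sub>L 'v. \<phi> (blinfun_apply R c))"
    by (rule bounded_linear_compose[OF finite_dim_linear_bounded[OF assms(2)] blinfun.bounded_linear_left])
  have eq: "blinfun_apply (f w) (\<phi> w *\<^sub>R c) = \<phi> (blinfun_apply (rank_one w (f w)) c)" for w
    by (simp add: rank_one.rep_eq blinfun.scaleR_right linear_scale[OF assms(2)])
  show "integrable M (\<lambda>w. blinfun_apply (f w) (\<phi> w *\<^sub>R c))"
    unfolding eq by (rule integrable_bounded_linear[OF bl assms(1)])
  show "(\<integral>w. blinfun_apply (f w) (\<phi> w *\<^sub>R c) \<partial>M)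
      = \<phi> (blinfun_apply (\<integral>w. rank_one w (f w) \<partial>M) c)"
    unfolding eq by (rule integral_bounded_linear[OF bl assms(1)])
qed

text \<open>Both sides are linear in \<open>B\<close>, the right one because every pairing with a
  matrix unit is integrable, so that sum and integral may be exchanged.\<close>

lemma trace_formula_matrix_units:
  fixes f :: "'v::finite_dim_normed \<Rightarrow> ('v \<Rightarrow>\<^sub>L real)"
  assumes int: "integrable M (\<lambda>w. rank_one w (f w))"
    and D: "finite D" "independent D" "span D = UNIV"
    and units: "\<And>b c. b \<in> D \<Longrightarrow> c \<in> D \<Longrightarrow> op_trace (\<lambda>w. representation D w b *\<^sub>R c)
      = r * (\<integral>w. blinfun_apply (f w) (representation D w b *\<^sub>R c) \<partial>M)"
    and B: "linear B"
  shows "op_trace B = r * (\<integral>w. blinfun_apply (f w) (B w) \<partial>M)"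
proof -
  let ?a = "\<lambda>p. representation D (B (fst p)) (snd p)"
    and ?E = "\<lambda>p w. representation D w (fst p) *\<^sub>R snd p"
  have B_eq: "B = (\<lambda>w. \<Sum>p\<in>D \<times> D. ?a p *\<^sub>R ?E p w)"
    using linear_matrix_units[OF D B] by (simp add: case_prod_unfold)
  have lin: "linear (\<lambda>w. representation D w b)" for b
    by (rule linear_representation[OF D(2,3)])
  have "op_trace B = (\<Sum>p\<in>D \<times> D. ?a p * op_trace (?E p))"
    by (subst B_eq) (intro op_trace_linear_combination linear_scaleR_left_compose lin)
  also have "\<dots> = r * (\<Sum>p\<in>D \<times> D. ?a p * (\<integral>w. blinfun_apply (f w) (?E p w) \<partial>M))"
    by (auto simp: units sum_distrib_left mult_ac intro!: sum.cong)
  also have "(\<Sum>p\<in>D \<times> D. ?a p * (\<integral>w. blinfun_apply (f w) (?E p w) \<partial>M))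
      = (\<integral>w. (\<Sum>p\<in>D \<times> D. ?a p * blinfun_apply (f w) (?E p w)) \<partial>M)"
    using integrable_pairing_rank_one[OF int lin]
    by (subst Bochner_Integration.integral_sum) auto
  also have "\<dots> = (\<integral>w. blinfun_apply (f w) (\<Sum>p\<in>D \<times> D. ?a p *\<^sub>R ?E p w) \<partial>M)"
    \<comment> \<open>Fixing the shape of the scalar pulls out only the entries \<open>?a p\<close>
      and leaves \<open>representation D w (fst p)\<close> inside the pairing.\<close>
    by (simp only: blinfun.sum_right blinfun.scaleR_right[of _ "representation D (B _) _"] real_scaleR_def)
  also have "\<dots> = (\<integral>w. blinfun_apply (f w) (B w) \<partial>M)"
    \<comment> \<open>The entries \<open>?a p\<close> contain \<open>B\<close> as well; the
      occurrence to expand is the one in \<open>B w\<close>.\<close>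
    by (subst (2) B_eq) (rule refl)
  finally show ?thesis .
qed

text \<open>Coordinates determine a vector: on the matrix unit for \<open>b\<close> and
  \<open>c\<close> the two sides of the trace formula are the \<open>b\<close>-coordinates of
  \<open>c\<close> and of \<open>?T c\<close>.\<close>

lemma resolution_of_identity_iff_trace_formula:
  fixes f :: "'v::finite_dim_normed \<Rightarrow> ('v \<Rightarrow>\<^sub>L real)"
  assumes int: "integrable M (\<lambda>w. rank_one w (f w))"
  shows "r *\<^sub>R (\<integral>w. rank_one w (f w) \<partial>M) = id_blinfun
    \<longleftrightarrow> (\<forall>B. linear B \<longrightarrow> op_trace B = r * (\<integral>w. blinfun_apply (f w) (B w) \<partial>M))"
    (is "?T = _ \<longleftrightarrow> ?trace")
proof -
  obtain D :: "'v set" where D: "finite D" "independent D" "span D = UNIV"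
    by (rule finite_dim_basis)
  have lin: "linear (\<lambda>w. representation D w b)" for b
    by (rule linear_representation[OF D(2,3)])
  have unit: "r * (\<integral>w. blinfun_apply (f w) (representation D w b *\<^sub>R c) \<partial>M)
      = representation D (blinfun_apply ?T c) b" for b c
    by (subst integral_pairing_rank_one[OF int lin])
      (simp add: blinfun.scaleR_left linear_scale[OF lin])
  show ?thesis
  proof
    assume T: "?T = id_blinfun"
    have "op_trace (\<lambda>w. representation D w b *\<^sub>R c)
        = r * (\<integral>w. blinfun_apply (f w) (representation D w b *\<^sub>R c) \<partial>M)" for b c
      unfolding op_trace_functional_scaleR[OF lin] unit T by simp
    then show ?trace using trace_formula_matrix_units[OF int D] by blast
  next
    assume tr: ?trace
    have "representation D (blinfun_apply ?T c) b = representation D c b" for b c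
      using tr[rule_format, OF linear_scaleR_left_compose[OF lin, of b c]]
      unfolding op_trace_functional_scaleR[OF lin] unit by (rule sym)
    then have "(\<Sum>b\<in>D. representation D (blinfun_apply ?T c) b *\<^sub>R b)
        = (\<Sum>b\<in>D. representation D c b *\<^sub>R b)" for c
      by (simp only:)
    then have "blinfun_apply ?T c = c" for c
      unfolding sum_representation[OF D] .
    then show "?T = id_blinfun" by (intro blinfun_eqI) (simp only: blinfun_apply_id_blinfun)
  qed
qed

section \<open>Induced operators as matrix units of the exterior power\<close>

lemma wedge_zero_factor:
  assumes "x i = 0"
  shows "wedge x = 0"
  using linear_0[OF linear_wedge[of x i]] assms by (metis fun_upd_triv)

text \<open>Injective families with a common range differ by the permutation
  \<open>inv x \<circ> z\<close> of positions, and permuting factors changes a wedge by at most a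
  sign.\<close>

lemma wedge_same_range:
  fixes x z :: "'k::finite \<Rightarrow> 'a::real_vector"
  assumes "inj x" "inj z" "range z = range x"
  shows "wedge z = wedge x \<or> wedge z = - wedge x"
proof -
  define p where "p = inv x \<circ> z"
  have xp: "x \<circ> p = z"
    using assms(3) by (auto simp: p_def fun_eq_iff) (metis f_inv_into_f rangeI)
  then have "inj p" using assms(2) by (metis inj_on_imageI2)
  then have "p permutes UNIV"
    by (intro bij_imp_permutes) (simp_all add: bij_def finite_UNIV_inj_surj)
  then show ?thesis using wedge_permute[of p x] xp by metis
qed

lemma ext_power_matrix_units:
  obtains D :: "('a::finite_dim_normed, 'k::finite) ext_power set"
  where "finite D" "independent D" "span D = UNIV"
    and "\<And>b c. b \<in> D \<Longrightarrow> c \<in> D \<Longrightarrow>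
      \<exists>A :: 'a \<Rightarrow> 'a. linear A \<and> ext_op A = (\<lambda>w. representation D w b *\<^sub>R c)"
proof -
  obtain X :: "'a set" where X: "finite X" "independent X" "span X = UNIV"
    by (rule finite_dim_basis)
  let ?W = "wedge ` {x :: 'k \<Rightarrow> 'a. range x \<subseteq> X}"
  \<comment> \<open>A maximal independent subset takes the place of the wedges of increasing
    families, so neither \<open>X\<close> nor the positions need an order.\<close>
  obtain D where D: "D \<subseteq> ?W" "independent D" "?W \<subseteq> span D"
    by (rule maximal_independent_subset)
  have "range wedge \<subseteq> span ?W" using wedge_in_span_basis[OF X(3)] by blast
  also have "\<dots> \<subseteq> span D" using D(3) by (intro span_minimal subspace_span)
  finally have spanD: "span D = UNIV"
    using span_minimal[OF _ subspace_span] span_wedge by blast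
  have "{x :: 'k \<Rightarrow> 'a. range x \<subseteq> X} = PiE UNIV (\<lambda>_. X)" by auto
  then have "finite ?W" using X(1) by (simp add: finite_PiE)
  then have finD: "finite D" using D(1) finite_subset by blast
  \<comment> \<open>A repeated factor would make the wedge 0, which no independent set
    contains.\<close>
  have inj: "inj x" if "wedge x \<in> D" for x :: "'k \<Rightarrow> 'a"
    using that D(2) dependent_zero wedge_eq_0 unfolding inj_def by metis
  have "\<exists>A :: 'a \<Rightarrow> 'a. linear A \<and> ext_op A = (\<lambda>w. representation D w b *\<^sub>R c)"
    if b: "b \<in> D" and c: "c \<in> D" for b c
  proof -
    obtain x y where x: "b = wedge x" "range x \<subseteq> X" and y: "c = wedge y"
      using b c D(1) by blast
    have injx: "inj x" using inj b x by simp
    \<comment> \<open>\<open>A\<close> carries \<open>x i\<close> to \<open>y i\<close>,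
      unambiguously since \<open>x\<close> is injective, and kills every other vector of
      \<open>X\<close>.\<close>
    obtain A where A: "linear A" "\<And>v. v \<in> X \<Longrightarrow> A v = (if v \<in> range x then y (inv x v) else 0)"
      using linear_independent_extend[OF X(2), of "\<lambda>v. if v \<in> range x then y (inv x v) else 0"]
      by blast
    have Ax: "A \<circ> x = y"
      using x(2) injx by (auto simp: fun_eq_iff A(2) image_subset_iff)
    have "ext_op A d = representation D d b *\<^sub>R c" if d: "d \<in> D" for d
    proof (cases "d = b")
      case True
      then show ?thesis
        using b by (simp add: representation_basis[OF D(2)] x y ext_op_wedge[OF A(1)] Ax)
    next
      case False
      obtain z where z: "d = wedge z" "range z \<subseteq> X" using d D(1) by blast
      \<comment> \<open>Independence excludes the sign that \<open>wedge_same_range\<close> leaves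
        open, so distinct members of \<open>D\<close> have different sets of factors.\<close>
      have "d \<noteq> - b"
      proof
        assume "d = - b"
        moreover have "b \<in> D - {d}" using False b by simp
        ultimately have "d \<in> span (D - {d})" using span_neg[OF span_base] by metis
        then show False using D(2) d unfolding dependent_def by blast
      qed
      then have "range z \<noteq> range x"
        using wedge_same_range[of x z] injx inj d False x(1) z(1) by auto
      moreover have "card (range z) = card (range x)"
        using injx inj d z(1) by (simp add: card_image)
      \<comment> \<open>Different sets of equal finite size: some factor of \<open>z\<close> lies
        outside \<open>range x\<close>; \<open>A\<close> kills it, hence the whole wedge.\<close>
      ultimately obtain i where i: "z i \<notin> range x"
        using card_subset_eq[of "range x" "range z"] by auto
      then have "(A \<circ> z) i = 0" using z(2) by (auto simp: A(2) image_subset_iff)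
      then have "ext_op A d = 0" by (simp add: z(1) ext_op_wedge[OF A(1)] wedge_zero_factor)
      then show ?thesis using False d by (simp add: representation_basis[OF D(2)])
    qed
    moreover have "linear (\<lambda>w. representation D w b *\<^sub>R c)"
      by (intro linear_scaleR_left_compose linear_representation[OF D(2) spanD])
    moreover have "w \<in> span D" for w using spanD by blast
    ultimately have "ext_op A w = representation D w b *\<^sub>R c" for w
      using linear_eq_on_span[OF linear_ext_op[OF A(1)], of "\<lambda>w. representation D w b *\<^sub>R c" D w]
      by blast
    then show ?thesis using A(1) by blast
  qed
  then show ?thesis using that finD D(2) spanD by blast
qed

section \<open>Integrability of the rank-one integrand\<close>

lemma bounded_bilinear_rank_one: "bounded_bilinear rank_one"
proof
  fix w w' :: 'a and f g :: "'a \<Rightarrow>\<^sub>L real" and r :: real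
  show "rank_one (w + w') f = rank_one w f + rank_one w' f"
    "rank_one w (f + g) = rank_one w f + rank_one w g"
    "rank_one (r *\<^sub>R w) f = r *\<^sub>R rank_one w f"
    "rank_one w (r *\<^sub>R f) = r *\<^sub>R rank_one w f"
    by (rule blinfun_eqI; simp add: rank_one.rep_eq blinfun.add_left blinfun.scaleR_left
        scaleR_add_left scaleR_add_right mult.commute)+
next
  have "norm (rank_one w f) \<le> norm w * norm f * 1" for w :: 'a and f
  proof (rule norm_blinfun_bound)
    show "norm (blinfun_apply (rank_one w f) z) \<le> norm w * norm f * 1 * norm z" for z
      using mult_right_mono[OF norm_blinfun[of f z] norm_ge_zero[of w]]
      by (simp add: rank_one.rep_eq mult_ac)
  qed simp
  then show "\<exists>K. \<forall>w f. norm (rank_one (w::'a) f) \<le> norm w * norm f * K" by blast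
qed

text \<open>On the sphere both \<open>w\<close> and its norming functional have norm 1, so the
  integrand is bounded, and the measure is finite. The completion expresses
  \<open>\<eta>\<close>-measurability of the selection.\<close>

lemma integrable_rank_one_norming:
  fixes \<eta> :: "'v::finite_dim_normed measure"
  assumes "finite_measure \<eta>" "sets \<eta> = sets (restrict_space borel (sphere 0 1))"
    and f: "f \<in> borel_measurable (completion \<eta>)"
    and norming: "\<forall>w\<in>sphere 0 1. norming_functional w (f w)"
  shows "integrable (completion \<eta>) (\<lambda>w. rank_one w (f w))"
proof -
  interpret bounded_bilinear "rank_one :: 'v \<Rightarrow> _" by (rule bounded_bilinear_rank_one)
  obtain K where K: "\<And>(w::'v) g. norm (rank_one w g) \<le> norm w * norm g * K"
    using bounded by blast
  have sp: "space \<eta> = sphere 0 1"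
    using sets_eq_imp_space_eq[OF assms(2)] by (simp add: space_restrict_space)
  interpret finite_measure "completion \<eta>"
    using assms(1) by (intro finite_measureI) (simp add: finite_measure.emeasure_finite)
  have "(\<lambda>w. w) \<in> borel_measurable \<eta>"
    unfolding measurable_cong_sets[OF assms(2) refl] by (rule measurable_restrict_space1) simp
  then have id: "(\<lambda>w. w) \<in> borel_measurable (completion \<eta>)"
    by (rule measurable_completion)
  have "continuous_on UNIV (\<lambda>p. rank_one (fst p :: 'v) (snd p))"
    by (intro continuous_on continuous_on_fst continuous_on_snd continuous_on_id)
  \<comment> \<open>Joint continuity in the pair gives measurability because finite-dimensional
    spaces are second countable.\<close>
  then have "(\<lambda>w. rank_one w (f w)) \<in> borel_measurable (completion \<eta>)"
    by (rule borel_measurable_continuous_Pair[OF id f])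
  moreover have "norm (rank_one w (f w)) \<le> K" if "w \<in> space \<eta>" for w
    using K[of w "f w"] norming that by (simp add: sp norming_functional_def)
  ultimately show ?thesis
    by (intro integrable_const_bound[of _ K]) auto
qed

theorem theorem1:
  fixes \<eta> :: "('a::finite_dim_normed, 'k::finite) ext_power measure"
    and sharp :: "('a, 'k) ext_power \<Rightarrow> (('a, 'k) ext_power \<Rightarrow>\<^sub>L real)"
    and N m :: nat
  assumes "dim (UNIV :: 'a set) = N"
    and "1 \<le> CARD('k)" and "CARD('k) \<le> N"
    and "m = dim (UNIV :: ('a, 'k) ext_power set)"
    and "prob_space \<eta>"
    and "sets \<eta> = sets (restrict_space borel (sphere 0 1))"
    and "sharp \<in> borel_measurable (completion \<eta>)"
    and "\<forall>w\<in>sphere 0 1. norming_functional w (sharp w)"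
  shows "(real m *\<^sub>R (\<integral>w. rank_one w (sharp w) \<partial>completion \<eta>) = id_blinfun
            \<longleftrightarrow> (\<forall>B :: ('a, 'k) ext_power \<Rightarrow> ('a, 'k) ext_power. linear B \<longrightarrow>
                   op_trace B = real m * (\<integral>w. blinfun_apply (sharp w) (B w) \<partial>completion \<eta>)))
       \<and> ((\<forall>B :: ('a, 'k) ext_power \<Rightarrow> ('a, 'k) ext_power. linear B \<longrightarrow>
                   op_trace B = real m * (\<integral>w. blinfun_apply (sharp w) (B w) \<partial>completion \<eta>))
            \<longleftrightarrow> (\<forall>A :: 'a \<Rightarrow> 'a. linear A \<longrightarrow>
                   op_trace (ext_op A :: ('a, 'k) ext_power \<Rightarrow> ('a, 'k) ext_power)
                     = real m * (\<integral>w. blinfun_apply (sharp w) (ext_op A w) \<partial>completion \<eta>)))"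
    (is "_ \<and> (?all \<longleftrightarrow> ?induced)")
proof -
  have int: "integrable (completion \<eta>) (\<lambda>w. rank_one w (sharp w))"
    using assms(5-8) by (intro integrable_rank_one_norming prob_space.finite_measure)
  \<comment> \<open>The matrix units of \<open>D\<close> are themselves induced operators, so
    \<open>tr\<close> provides the formula on each of them.\<close>
  have "?all" if tr: "?induced"
  proof -
    obtain D :: "('a, 'k) ext_power set" where D: "finite D" "independent D" "span D = UNIV"
      and units: "\<And>b c. b \<in> D \<Longrightarrow> c \<in> D \<Longrightarrow>
        \<exists>A :: 'a \<Rightarrow> 'a. linear A \<and> ext_op A = (\<lambda>w. representation D w b *\<^sub>R c)"
      by (rule ext_power_matrix_units) blast
    have "op_trace (\<lambda>w. representation D w b *\<^sub>R c) = real m *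
        (\<integral>w. blinfun_apply (sharp w) (representation D w b *\<^sub>R c) \<partial>completion \<eta>)"
      if bc: "b \<in> D" "c \<in> D" for b c
    proof -
      obtain A :: "'a \<Rightarrow> 'a" where A: "linear A" "ext_op A = (\<lambda>w. representation D w b *\<^sub>R c)"
        using units[OF bc] by blast
      show ?thesis using tr[rule_format, OF A(1)] unfolding A(2) .
    qed
    then show ?all using trace_formula_matrix_units[OF int D] by blast
  qed
  \<comment> \<open>Induced operators are linear, so the formula for them is a special case.\<close>
  moreover have "?induced" if "?all" using that linear_ext_op by blast
  ultimately show ?thesis
    using resolution_of_identity_iff_trace_formula[OF int, of "real m"] by blast
qed

end
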